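(* Let $\mathbb{X}$ be a pointed regular category with cokernels. Then $\mathbb{X}$ is normal if and only if the following condition holds: a morphism in $\mathbb{X}$ is a monomorphism if and only if its kernel is $0$.
   Context: A pointed regular category is called normal if every regular epimorphism in it is a normal epimorphism (i.e. a cokernel of some morphism). "With cokernels" means that every morphism has a cokernel. *)

theory Defs
  imports Main
begin

record ('o, 'a) cat =
  Obj :: "'o set"
  Arr :: "'a set"
  Dom :: "'a \<Rightarrow> 'o"
  Cod :: "'a \<Rightarrow> 'o"
  Idt :: "'o \<Rightarrow> 'a"
  Cmp :: "'a \<Rightarrow> 'a \<Rightarrow> 'a"  (infixl "\<cdot>\<index>" 70)

text \<open>Composition is in applicative order: \<open>g \<cdot>\<^bsub>C\<^esub> f\<close> is \<open>g\<close> after \<open>f\<close>.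
  The operations are only constrained on objects, arrows and composable pairs.\<close>

definition hom :: "('o, 'a) cat \<Rightarrow> 'o \<Rightarrow> 'o \<Rightarrow> 'a set" where
  "hom C A B = {f \<in> Arr C. Dom C f = A \<and> Cod C f = B}"

locale category =
  fixes C :: "('o, 'a) cat" (structure)
  assumes dom_obj: "f \<in> Arr C \<Longrightarrow> Dom C f \<in> Obj C"
    and cod_obj: "f \<in> Arr C \<Longrightarrow> Cod C f \<in> Obj C"
    and idt_hom: "A \<in> Obj C \<Longrightarrow> Idt C A \<in> hom C A A"
    and cmp_hom: "\<lbrakk>f \<in> hom C A B; g \<in> hom C B D\<rbrakk> \<Longrightarrow> g \<cdot> f \<in> hom C A D"
    and idt_left: "f \<in> hom C A B \<Longrightarrow> Idt C B \<cdot> f = f"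
    and idt_right: "f \<in> hom C A B \<Longrightarrow> f \<cdot> Idt C A = f"
    and assoc: "\<lbrakk>f \<in> hom C A B; g \<in> hom C B D; h \<in> hom C D E\<rbrakk>
      \<Longrightarrow> h \<cdot> (g \<cdot> f) = (h \<cdot> g) \<cdot> f"

definition is_functor ::
  "('i, 'u) cat \<Rightarrow> ('o, 'a) cat \<Rightarrow> ('i \<Rightarrow> 'o) \<Rightarrow> ('u \<Rightarrow> 'a) \<Rightarrow> bool" where
  "is_functor J C F0 F1 \<longleftrightarrow> category J \<and> category C
    \<and> (\<forall>i\<in>Obj J. F0 i \<in> Obj C)
    \<and> (\<forall>u\<in>Arr J. F1 u \<in> hom C (F0 (Dom J u)) (F0 (Cod J u)))
    \<and> (\<forall>i\<in>Obj J. F1 (Idt J i) = Idt C (F0 i))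
    \<and> (\<forall>u\<in>Arr J. \<forall>v\<in>Arr J. Dom J v = Cod J u \<longrightarrow> F1 (v \<cdot>\<^bsub>J\<^esub> u) = F1 v \<cdot>\<^bsub>C\<^esub> F1 u)"

definition is_cone ::
  "('i, 'u) cat \<Rightarrow> ('o, 'a) cat \<Rightarrow> ('i \<Rightarrow> 'o) \<Rightarrow> ('u \<Rightarrow> 'a) \<Rightarrow> 'o \<Rightarrow> ('i \<Rightarrow> 'a) \<Rightarrow> bool" where
  "is_cone J C F0 F1 X p \<longleftrightarrow> X \<in> Obj C
    \<and> (\<forall>i\<in>Obj J. p i \<in> hom C X (F0 i))
    \<and> (\<forall>u\<in>Arr J. F1 u \<cdot>\<^bsub>C\<^esub> p (Dom J u) = p (Cod J u))"

definition is_limit ::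
  "('i, 'u) cat \<Rightarrow> ('o, 'a) cat \<Rightarrow> ('i \<Rightarrow> 'o) \<Rightarrow> ('u \<Rightarrow> 'a) \<Rightarrow> 'o \<Rightarrow> ('i \<Rightarrow> 'a) \<Rightarrow> bool" where
  "is_limit J C F0 F1 X p \<longleftrightarrow> is_cone J C F0 F1 X p
    \<and> (\<forall>Y q. is_cone J C F0 F1 Y q \<longrightarrow>
         (\<exists>!h. h \<in> hom C Y X \<and> (\<forall>i\<in>Obj J. p i \<cdot>\<^bsub>C\<^esub> h = q i)))"

text \<open>Every finite category is isomorphic to one whose objects and arrows are natural
  numbers, so it suffices to quantify over index categories of the following type.\<close>

definition finitely_complete :: "('o, 'a) cat \<Rightarrow> bool" where
  "finitely_complete C \<longleftrightarrow>
    (\<forall>(J :: (nat, nat) cat) F0 F1. finite (Obj J) \<and> finite (Arr J) \<and> is_functor J C F0 F1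
       \<longrightarrow> (\<exists>X p. is_limit J C F0 F1 X p))"

definition is_mono :: "('o, 'a) cat \<Rightarrow> 'a \<Rightarrow> bool" where
  "is_mono C f \<longleftrightarrow> f \<in> Arr C
    \<and> (\<forall>X. \<forall>g\<in>hom C X (Dom C f). \<forall>h\<in>hom C X (Dom C f).
         f \<cdot>\<^bsub>C\<^esub> g = f \<cdot>\<^bsub>C\<^esub> h \<longrightarrow> g = h)"

definition is_pullback :: "('o, 'a) cat \<Rightarrow> 'a \<Rightarrow> 'a \<Rightarrow> 'a \<Rightarrow> 'a \<Rightarrow> bool" where
  "is_pullback C f g p q \<longleftrightarrow>
    f \<in> Arr C \<and> g \<in> Arr C \<and> p \<in> Arr C \<and> q \<in> Arr C
    \<and> Cod C f = Cod C g \<and> Dom C p = Dom C q \<and> Cod C p = Dom C f \<and> Cod C q = Dom C g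
    \<and> f \<cdot>\<^bsub>C\<^esub> p = g \<cdot>\<^bsub>C\<^esub> q
    \<and> (\<forall>X. \<forall>x\<in>hom C X (Dom C f). \<forall>y\<in>hom C X (Dom C g).
         f \<cdot>\<^bsub>C\<^esub> x = g \<cdot>\<^bsub>C\<^esub> y \<longrightarrow>
           (\<exists>!h. h \<in> hom C X (Dom C p) \<and> p \<cdot>\<^bsub>C\<^esub> h = x \<and> q \<cdot>\<^bsub>C\<^esub> h = y))"

definition is_kernel_pair :: "('o, 'a) cat \<Rightarrow> 'a \<Rightarrow> 'a \<Rightarrow> 'a \<Rightarrow> bool" where
  "is_kernel_pair C f p q \<longleftrightarrow> is_pullback C f f p q"

definition is_coequalizer :: "('o, 'a) cat \<Rightarrow> 'a \<Rightarrow> 'a \<Rightarrow> 'a \<Rightarrow> bool" where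
  "is_coequalizer C f g e \<longleftrightarrow>
    f \<in> Arr C \<and> g \<in> Arr C \<and> e \<in> Arr C
    \<and> Dom C f = Dom C g \<and> Cod C f = Cod C g \<and> Dom C e = Cod C f
    \<and> e \<cdot>\<^bsub>C\<^esub> f = e \<cdot>\<^bsub>C\<^esub> g
    \<and> (\<forall>X. \<forall>x\<in>hom C (Cod C f) X. x \<cdot>\<^bsub>C\<^esub> f = x \<cdot>\<^bsub>C\<^esub> g \<longrightarrow>
         (\<exists>!h. h \<in> hom C (Cod C e) X \<and> h \<cdot>\<^bsub>C\<^esub> e = x))"

definition is_regular_epi :: "('o, 'a) cat \<Rightarrow> 'a \<Rightarrow> bool" where
  "is_regular_epi C e \<longleftrightarrow> (\<exists>f g. is_coequalizer C f g e)"

definition regular_category :: "('o, 'a) cat \<Rightarrow> bool" where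
  "regular_category C \<longleftrightarrow> category C \<and> finitely_complete C
    \<and> (\<forall>f p q. is_kernel_pair C f p q \<longrightarrow> (\<exists>e. is_coequalizer C p q e))
    \<and> (\<forall>f g p q. is_pullback C f g p q \<and> is_regular_epi C f \<longrightarrow> is_regular_epi C q)"

definition is_zero_object :: "('o, 'a) cat \<Rightarrow> 'o \<Rightarrow> bool" where
  "is_zero_object C Z \<longleftrightarrow> Z \<in> Obj C
    \<and> (\<forall>A\<in>Obj C. (\<exists>!f. f \<in> hom C Z A) \<and> (\<exists>!f. f \<in> hom C A Z))"

definition pointed_category :: "('o, 'a) cat \<Rightarrow> bool" where
  "pointed_category C \<longleftrightarrow> category C \<and> (\<exists>Z. is_zero_object C Z)"

definition is_zero_morphism :: "('o, 'a) cat \<Rightarrow> 'a \<Rightarrow> bool" where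
  "is_zero_morphism C f \<longleftrightarrow> f \<in> Arr C
    \<and> (\<exists>Z. is_zero_object C Z \<and> (\<exists>u\<in>hom C (Dom C f) Z. \<exists>v\<in>hom C Z (Cod C f). f = v \<cdot>\<^bsub>C\<^esub> u))"

definition is_kernel :: "('o, 'a) cat \<Rightarrow> 'a \<Rightarrow> 'a \<Rightarrow> bool" where
  "is_kernel C f k \<longleftrightarrow> f \<in> Arr C \<and> k \<in> Arr C \<and> Cod C k = Dom C f
    \<and> is_zero_morphism C (f \<cdot>\<^bsub>C\<^esub> k)
    \<and> (\<forall>X. \<forall>x\<in>hom C X (Dom C f). is_zero_morphism C (f \<cdot>\<^bsub>C\<^esub> x) \<longrightarrow>
         (\<exists>!h. h \<in> hom C X (Dom C k) \<and> k \<cdot>\<^bsub>C\<^esub> h = x))"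

definition is_cokernel :: "('o, 'a) cat \<Rightarrow> 'a \<Rightarrow> 'a \<Rightarrow> bool" where
  "is_cokernel C f c \<longleftrightarrow> f \<in> Arr C \<and> c \<in> Arr C \<and> Dom C c = Cod C f
    \<and> is_zero_morphism C (c \<cdot>\<^bsub>C\<^esub> f)
    \<and> (\<forall>X. \<forall>x\<in>hom C (Cod C f) X. is_zero_morphism C (x \<cdot>\<^bsub>C\<^esub> f) \<longrightarrow>
         (\<exists>!h. h \<in> hom C (Cod C c) X \<and> h \<cdot>\<^bsub>C\<^esub> c = x))"

definition has_cokernels :: "('o, 'a) cat \<Rightarrow> bool" where
  "has_cokernels C \<longleftrightarrow> (\<forall>f\<in>Arr C. \<exists>c. is_cokernel C f c)"

definition is_normal_epi :: "('o, 'a) cat \<Rightarrow> 'a \<Rightarrow> bool" where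
  "is_normal_epi C e \<longleftrightarrow> (\<exists>f. is_cokernel C f e)"

definition normal_category :: "('o, 'a) cat \<Rightarrow> bool" where
  "normal_category C \<longleftrightarrow> pointed_category C \<and> regular_category C
    \<and> (\<forall>e. is_regular_epi C e \<longrightarrow> is_normal_epi C e)"

text \<open>Kernels are unique up to isomorphism, so the kernel of \<open>f\<close> is 0 precisely when
  some kernel of \<open>f\<close> has a zero object as its domain.\<close>

definition has_zero_kernel :: "('o, 'a) cat \<Rightarrow> 'a \<Rightarrow> bool" where
  "has_zero_kernel C f \<longleftrightarrow> (\<exists>k. is_kernel C f k \<and> is_zero_object C (Dom C k))"

end

theory Submission
  imports Defs
begin

text \<open>Suppose regular epimorphisms are normal and \<open>f\<close> has zero kernel. The coequalizer \<open>e\<close> of the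
  kernel pair \<open>(p, q)\<close> of \<open>f\<close> is a cokernel of some \<open>g\<close>, and \<open>f\<close> factors through \<open>e\<close>, so
  \<open>f \<cdot> g = 0\<close> and hence \<open>g = 0\<close>. Therefore \<open>e\<close> is a split monomorphism, \<open>p = q\<close>, and \<open>f\<close> is a
  monomorphism.

  Conversely, let \<open>e\<close> be a regular epimorphism, \<open>k\<close> its kernel and \<open>c\<close> the cokernel of \<open>k\<close>, so that
  \<open>e = m \<cdot> c\<close>. If \<open>m \<cdot> x = 0\<close>, pull \<open>x\<close> back along the regular epimorphism \<open>c\<close>: the resulting arrow
  is killed by \<open>e\<close>, so it factors through \<open>k\<close> and is killed by \<open>c\<close>, and \<open>x = 0\<close> follows. Thus \<open>m\<close>
  has zero kernel, so it is a monomorphism by hypothesis, which makes \<open>e\<close>, like \<open>c\<close>, a cokernel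
  of \<open>k\<close>.\<close>

section \<open>Hom-sets, and pullbacks as limits over a cospan\<close>

lemma regular_category_finitely_complete: "regular_category C \<Longrightarrow> finitely_complete C"
  by (simp add: regular_category_def)

lemma hom_ArrD: "f \<in> hom C A B \<Longrightarrow> f \<in> Arr C"
  and hom_DomD: "f \<in> hom C A B \<Longrightarrow> Dom C f = A"
  and hom_CodD: "f \<in> hom C A B \<Longrightarrow> Cod C f = B"
  by (simp_all add: hom_def)

lemmas homD = hom_ArrD hom_DomD hom_CodD

text \<open>The shape \<open>0 \<rightarrow> 2 \<leftarrow> 1\<close>: arrows \<open>3\<close> and \<open>4\<close> are the two legs, the others are identities.\<close>

definition cospan_cat :: "(nat, nat) cat" where
  "cospan_cat = \<lparr>Obj = {0, 1, 2}, Arr = {0, 1, 2, 3, 4},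
    Dom = (\<lambda>u. if u = 3 then 0 else if u = 4 then 1 else u),
    Cod = (\<lambda>u. if u = 3 \<or> u = 4 then 2 else u),
    Idt = (\<lambda>i. i), Cmp = (\<lambda>v u. if u \<le> 2 then v else u)\<rparr>"

lemma cospan_cat_simps [simp]:
  "Obj cospan_cat = {0, 1, 2}" "Arr cospan_cat = {0, 1, 2, 3, 4}"
  "Dom cospan_cat u = (if u = 3 then 0 else if u = 4 then 1 else u)"
  "Cod cospan_cat u = (if u = 3 \<or> u = 4 then 2 else u)"
  "Idt cospan_cat i = i" "v \<cdot>\<^bsub>cospan_cat\<^esub> u = (if u \<le> 2 then v else u)"
  by (simp_all add: cospan_cat_def)

text \<open>Arrows \<open>3\<close> and \<open>4\<close> both end at \<open>2\<close>, where only an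
  identity starts, so in any composable pair one factor is an identity and the composite is the
  other factor. This is why a test on \<open>u\<close> alone suffices in \<open>Cmp\<close>.\<close>

lemma category_cospan_cat: "category cospan_cat"
  by unfold_locales (auto simp: hom_def split: if_splits)

context category
begin

lemma hom_objD: "f \<in> hom C A B \<Longrightarrow> A \<in> Obj C" "f \<in> hom C A B \<Longrightarrow> B \<in> Obj C"
  using dom_obj cod_obj by (auto simp: hom_def)

text \<open>List lookup encodes the diagram: position \<open>i\<close> of each list is the image of
  object or arrow \<open>i\<close>, with the legs \<open>f\<close> and \<open>g\<close> at positions
  \<open>3\<close> and \<open>4\<close>.\<close>

lemma cospan_functor:
  assumes f: "f \<in> hom C A D" and g: "g \<in> hom C B D"
  shows "is_functor cospan_cat C ((!) [A, B, D]) ((!) [Idt C A, Idt C B, Idt C D, f, g])"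
proof -
  have "A \<in> Obj C" "B \<in> Obj C" "D \<in> Obj C"
    using f g hom_objD by blast+
  moreover from this have I: "Idt C A \<in> hom C A A" "Idt C B \<in> hom C B B" "Idt C D \<in> hom C D D"
    by (simp_all add: idt_hom)
  moreover note idt_left[OF I(1)] idt_left[OF I(2)] idt_left[OF I(3)]
    idt_left[OF f] idt_right[OF f] idt_left[OF g] idt_right[OF g]
  ultimately show ?thesis
    using f g category_cospan_cat category_axioms by (simp add: is_functor_def)
qed

text \<open>Arrow \<open>3\<close> forces the leg at \<open>2\<close>, arrow \<open>4\<close> then
  gives commutativity of the square, and the identity arrows impose only identity laws.\<close>

lemma cospan_cone_iff:
  assumes f: "f \<in> hom C A D" and g: "g \<in> hom C B D"
  shows "is_cone cospan_cat C ((!) [A, B, D]) ((!) [Idt C A, Idt C B, Idt C D, f, g]) X p \<longleftrightarrow>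
    p 0 \<in> hom C X A \<and> p 1 \<in> hom C X B \<and> p 2 = f \<cdot> p 0 \<and> f \<cdot> p 0 = g \<cdot> p 1"
proof -
  have "f \<cdot> p 0 \<in> hom C X D \<and> X \<in> Obj C" if "p 0 \<in> hom C X A"
    using cmp_hom[OF that f] hom_objD[OF that] by simp
  moreover have "Idt C A \<cdot> p 0 = p 0" if "p 0 \<in> hom C X A"
    using idt_left[OF that] .
  moreover have "Idt C B \<cdot> p 1 = p 1" if "p 1 \<in> hom C X B"
    using idt_left[OF that] .
  moreover have "Idt C D \<cdot> p 2 = p 2" if "p 2 \<in> hom C X D"
    using idt_left[OF that] .
  ultimately show ?thesis
    by (auto simp: is_cone_def)
qed

lemma ex_pullback:
  assumes "finitely_complete C" and f: "f \<in> hom C A D" and g: "g \<in> hom C B D"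
  obtains p q where "is_pullback C f g p q"
proof -
  let ?F0 = "(!) [A, B, D]" and ?F1 = "(!) [Idt C A, Idt C B, Idt C D, f, g]"
  let ?cone = "is_cone cospan_cat C ?F0 ?F1"
  have "finite (Obj cospan_cat)" "finite (Arr cospan_cat)"
    by simp_all
  then have "\<exists>P r. is_limit cospan_cat C ?F0 ?F1 P r"
    using assms(1)[unfolded finitely_complete_def, rule_format, of cospan_cat ?F0 ?F1]
      cospan_functor[OF f g] by simp
  then obtain P r where lim: "is_limit cospan_cat C ?F0 ?F1 P r"
    by auto
  then have cone: "?cone P r"
    by (simp add: is_limit_def)
  have r: "r 0 \<in> hom C P A" "r 1 \<in> hom C P B" "r 2 = f \<cdot> r 0" "f \<cdot> r 0 = g \<cdot> r 1"
    using cone by (simp_all add: cospan_cone_iff[OF f g])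
  have "\<exists>!h. h \<in> hom C X P \<and> r 0 \<cdot> h = x \<and> r 1 \<cdot> h = y"
    if x: "x \<in> hom C X A" and y: "y \<in> hom C X B" and eq: "f \<cdot> x = g \<cdot> y" for X x y
  proof -
    let ?s = "(!) [x, y, f \<cdot> x]"
    have "?cone X ?s"
      using x y eq by (simp add: cospan_cone_iff[OF f g])
    \<comment> \<open>The condition at \<open>2\<close> follows from the one at \<open>0\<close> by
      associativity, so mediating arrows for the limit and for the pullback are the same.\<close>
    moreover have "(\<forall>i\<in>Obj cospan_cat. r i \<cdot> h = ?s i) \<longleftrightarrow> r 0 \<cdot> h = x \<and> r 1 \<cdot> h = y"
      if "h \<in> hom C X P" for h
      using assoc[OF that r(1) f] r(3) by auto
    ultimately show ?thesis
      using lim[unfolded is_limit_def, THEN conjunct2, rule_format, of X ?s] by (simp cong: conj_cong)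
  qed
  then have "is_pullback C f g (r 0) (r 1)"
    using r f g by (simp_all add: is_pullback_def hom_def)
  then show thesis ..
qed

text \<open>Coequalizers are epimorphisms: \<open>x\<close> and \<open>y\<close> both mediate the
  arrow \<open>y \<cdot> e\<close>, which identifies \<open>f\<close> and \<open>g\<close> because
  \<open>e\<close> does.\<close>

lemma coequalizer_cancel:
  assumes "is_coequalizer C f g e" and x: "x \<in> hom C (Cod C e) X" and y: "y \<in> hom C (Cod C e) X"
    and "x \<cdot> e = y \<cdot> e"
  shows "x = y"
proof -
  have fg: "f \<in> hom C (Dom C f) (Cod C f)" "g \<in> hom C (Dom C f) (Cod C f)"
      "e \<in> hom C (Cod C f) (Cod C e)" "e \<cdot> f = e \<cdot> g"
    using assms(1) by (simp_all add: is_coequalizer_def hom_def)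
  have "y \<cdot> e \<in> hom C (Cod C f) X"
    using cmp_hom fg y by blast
  moreover have "(y \<cdot> e) \<cdot> f = (y \<cdot> e) \<cdot> g"
    using assoc fg y by metis
  ultimately have "\<exists>!h. h \<in> hom C (Cod C e) X \<and> h \<cdot> e = y \<cdot> e"
    using assms(1) unfolding is_coequalizer_def by blast
  then show ?thesis
    using assms by blast
qed

section \<open>Zero objects and zero morphisms\<close>

lemma zero_object_to_unique:
  assumes Z: "is_zero_object C Z" and f: "f \<in> hom C A Z" and g: "g \<in> hom C A Z"
  shows "f = g"
proof -
  have "\<exists>!h. h \<in> hom C A Z"
    using Z hom_objD(1)[OF f] by (simp add: is_zero_object_def)
  then show ?thesis
    using f g by metis
qed

lemma zero_object_from_unique:
  assumes Z: "is_zero_object C Z" and f: "f \<in> hom C Z A" and g: "g \<in> hom C Z A"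
  shows "f = g"
proof -
  have "\<exists>!h. h \<in> hom C Z A"
    using Z hom_objD(2)[OF f] by (simp add: is_zero_object_def)
  then show ?thesis
    using f g by metis
qed

lemma zero_object_exE:
  assumes Z: "is_zero_object C Z" and A: "A \<in> Obj C"
  obtains u v where "u \<in> hom C A Z" "v \<in> hom C Z A"
proof -
  have "\<exists>!f. f \<in> hom C Z A" "\<exists>!f. f \<in> hom C A Z"
    using assms by (simp_all add: is_zero_object_def)
  then show thesis
    using that by (elim ex1E)
qed

lemma zero_morphismI:
  assumes "is_zero_object C Z" and u: "u \<in> hom C A Z" and v: "v \<in> hom C Z B"
  shows "is_zero_morphism C (v \<cdot> u)"
proof -
  have "v \<cdot> u \<in> hom C A B"
    using cmp_hom[OF u v] .
  then show ?thesis
    unfolding is_zero_morphism_def using assms by (metis homD)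
qed

lemma zero_morphismE:
  assumes "is_zero_morphism C f" and "f \<in> hom C A B"
  obtains Z u v where "is_zero_object C Z" "u \<in> hom C A Z" "v \<in> hom C Z B" "f = v \<cdot> u"
  using assms unfolding is_zero_morphism_def by (metis hom_DomD hom_CodD)

lemma zero_morphism_comp_right:
  assumes "is_zero_morphism C f" and f: "f \<in> hom C B D" and g: "g \<in> hom C A B"
  shows "is_zero_morphism C (f \<cdot> g)"
proof -
  obtain Z u v where Z: "is_zero_object C Z" "u \<in> hom C B Z" "v \<in> hom C Z D" "f = v \<cdot> u"
    using zero_morphismE[OF assms(1) f] .
  have "f \<cdot> g = v \<cdot> (u \<cdot> g)"
    using assoc[OF g Z(2,3)] Z(4) by simp
  then show ?thesis
    using zero_morphismI[OF Z(1) cmp_hom[OF g Z(2)] Z(3)] by simp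
qed

lemma zero_morphism_comp_left:
  assumes "is_zero_morphism C f" and f: "f \<in> hom C A B" and g: "g \<in> hom C B D"
  shows "is_zero_morphism C (g \<cdot> f)"
proof -
  obtain Z u v where Z: "is_zero_object C Z" "u \<in> hom C A Z" "v \<in> hom C Z B" "f = v \<cdot> u"
    using zero_morphismE[OF assms(1) f] .
  have "g \<cdot> f = (g \<cdot> v) \<cdot> u"
    using assoc[OF Z(2,3) g] Z(4) by simp
  then show ?thesis
    using zero_morphismI[OF Z(1,2) cmp_hom[OF Z(3) g]] by simp
qed

text \<open>The two arrows may factor through different zero objects; the arrow \<open>w\<close>
  between these turns one factorization into the other.\<close>

lemma zero_morphism_unique:
  assumes "is_zero_morphism C f" "is_zero_morphism C g" and f: "f \<in> hom C A B" and g: "g \<in> hom C A B"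
  shows "f = g"
proof -
  obtain Z u v where Z: "is_zero_object C Z" "u \<in> hom C A Z" "v \<in> hom C Z B" "f = v \<cdot> u"
    using zero_morphismE[OF assms(1) f] .
  obtain Y s t where Y: "is_zero_object C Y" "s \<in> hom C A Y" "t \<in> hom C Y B" "g = t \<cdot> s"
    using zero_morphismE[OF assms(2) g] .
  obtain w where w: "w \<in> hom C Z Y"
    using zero_object_exE[OF Z(1) hom_objD(1)[OF Y(3)]] .
  have "w \<cdot> u = s"
    using zero_object_to_unique[OF Y(1) cmp_hom[OF Z(2) w] Y(2)] .
  moreover have "t \<cdot> w = v"
    using zero_object_from_unique[OF Z(1) cmp_hom[OF w Y(3)] Z(3)] .
  ultimately show ?thesis
    using assoc[OF Z(2) w Y(3)] Z(4) Y(4) by simp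
qed

lemma zero_object_homs:
  assumes "is_zero_object C Z" and "A \<in> Obj C"
  obtains u v where "u \<in> hom C A Z" "v \<in> hom C Z A"
    "is_zero_morphism C u" "is_zero_morphism C v"
proof -
  obtain u v where uv: "u \<in> hom C A Z" "v \<in> hom C Z A"
    using zero_object_exE[OF assms] .
  have I: "Idt C Z \<in> hom C Z Z"
    using assms(1) idt_hom by (simp add: is_zero_object_def)
  have u: "is_zero_morphism C u"
    using zero_morphismI[OF assms(1) uv(1) I] idt_left[OF uv(1)] by simp
  have v: "is_zero_morphism C v"
    using zero_morphismI[OF assms(1) I uv(2)] idt_right[OF uv(2)] by simp
  show thesis
    using that uv u v by blast
qed

lemma ex_zero_morphism:
  assumes "is_zero_object C Z" and "A \<in> Obj C" and "B \<in> Obj C"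
  obtains z where "z \<in> hom C A B" "is_zero_morphism C z"
proof -
  obtain u where u: "u \<in> hom C A Z"
    using zero_object_exE[OF assms(1,2)] .
  obtain v where v: "v \<in> hom C Z B"
    using zero_object_exE[OF assms(1,3)] .
  show thesis
    using that[OF cmp_hom[OF u v] zero_morphismI[OF assms(1) u v]] .
qed

section \<open>Kernels, cokernels and their universal properties\<close>

lemma kernel_factorE:
  assumes "is_kernel C f k" and "x \<in> hom C X (Dom C f)" and "is_zero_morphism C (f \<cdot> x)"
  obtains h where "h \<in> hom C X (Dom C k)" "k \<cdot> h = x"
  using assms unfolding is_kernel_def by blast

lemma cokernel_factorE:
  assumes "is_cokernel C f c" and "x \<in> hom C (Cod C f) X" and "is_zero_morphism C (x \<cdot> f)"
  obtains h where "h \<in> hom C (Cod C c) X" "h \<cdot> c = x"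
  using assms unfolding is_cokernel_def by blast

lemma coequalizer_factorE:
  assumes "is_coequalizer C f g e" and "x \<in> hom C (Cod C f) X" and "x \<cdot> f = x \<cdot> g"
  obtains h where "h \<in> hom C (Cod C e) X" "h \<cdot> e = x"
  using assms unfolding is_coequalizer_def by blast

lemma zero_kernelD:
  assumes "has_zero_kernel C f" and x: "x \<in> hom C X (Dom C f)" and "is_zero_morphism C (f \<cdot> x)"
  shows "is_zero_morphism C x"
proof -
  obtain k where k: "is_kernel C f k" and Z: "is_zero_object C (Dom C k)"
    using assms(1) by (auto simp: has_zero_kernel_def)
  then obtain h where h: "h \<in> hom C X (Dom C k)" "k \<cdot> h = x"
    using kernel_factorE assms(2,3) by metis
  have "k \<in> hom C (Dom C k) (Dom C f)"
    using k by (simp add: is_kernel_def hom_def)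
  then show ?thesis
    using zero_morphismI[OF Z h(1)] h(2) by blast
qed

text \<open>With \<open>zero_kernelD\<close> this turns a zero kernel into a cancellation property:
  arrows killed by \<open>f\<close> are zero. The kernel exhibited is the arrow from
  \<open>Z\<close>.\<close>

lemma zero_kernelI:
  assumes "is_zero_object C Z" and f: "f \<in> Arr C"
    and zero: "\<And>X x. x \<in> hom C X (Dom C f) \<Longrightarrow> is_zero_morphism C (f \<cdot> x) \<Longrightarrow> is_zero_morphism C x"
  shows "has_zero_kernel C f"
proof -
  obtain v where v: "v \<in> hom C Z (Dom C f)" "is_zero_morphism C v"
    using zero_object_homs[OF assms(1) dom_obj[OF f]] by blast
  have fh: "f \<in> hom C (Dom C f) (Cod C f)"
    using f by (simp add: hom_def)
  have "\<exists>!h. h \<in> hom C X Z \<and> v \<cdot> h = x"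
    if x: "x \<in> hom C X (Dom C f)" and fx: "is_zero_morphism C (f \<cdot> x)" for X x
  proof -
    have uniq: "\<exists>!h. h \<in> hom C X Z"
      using assms(1) hom_objD(1)[OF x] by (simp add: is_zero_object_def)
    \<comment> \<open>Both sides are zero morphisms between the same objects.\<close>
    moreover have "v \<cdot> h = x" if h: "h \<in> hom C X Z" for h
      using zero_morphism_unique[OF zero_morphism_comp_right[OF v(2,1) h] zero[OF x fx]]
        cmp_hom[OF h v(1)] x by blast
    ultimately show ?thesis
      by blast
  qed
  then have "is_kernel C f v"
    using f v zero_morphism_comp_left[OF v(2,1) fh] by (simp_all add: is_kernel_def hom_def)
  then show ?thesis
    using v assms(1) by (auto simp: has_zero_kernel_def hom_def)
qed

lemma mono_zero_kernel:
  assumes Z: "is_zero_object C Z" and "is_mono C f"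
  shows "has_zero_kernel C f"
proof (rule zero_kernelI[OF Z])
  show f: "f \<in> Arr C"
    using assms(2) by (simp add: is_mono_def)
  fix X x
  assume x: "x \<in> hom C X (Dom C f)" and fx: "is_zero_morphism C (f \<cdot> x)"
  have fh: "f \<in> hom C (Dom C f) (Cod C f)"
    using f by (simp add: hom_def)
  obtain z where z: "z \<in> hom C X (Dom C f)" "is_zero_morphism C z"
    using ex_zero_morphism[OF Z hom_objD[OF x]] .
  have "f \<cdot> x = f \<cdot> z"
    using zero_morphism_unique fx zero_morphism_comp_left[OF z(2,1) fh] cmp_hom x z(1) fh by blast
  then show "is_zero_morphism C x"
    using assms(2) x z unfolding is_mono_def by blast
qed

text \<open>The kernel of \<open>f\<close> is the pullback along \<open>f\<close> of the arrow from
  the zero object to \<open>B\<close>.\<close>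

lemma ex_kernel:
  assumes Z: "is_zero_object C Z" and "finitely_complete C" and f: "f \<in> hom C A B"
  obtains k where "is_kernel C f k"
proof -
  have "B \<in> Obj C"
    using f hom_objD by blast
  then obtain v where v: "v \<in> hom C Z B" "is_zero_morphism C v"
    using zero_object_homs[OF Z] by blast
  obtain k q where pb: "is_pullback C f v k q"
    using ex_pullback[OF assms(2) f v(1)] .
  have k: "k \<in> hom C (Dom C k) A" and q: "q \<in> hom C (Dom C k) Z" and "f \<cdot> k = v \<cdot> q"
    using pb f v by (simp_all add: is_pullback_def hom_def)
  then have "is_zero_morphism C (f \<cdot> k)"
    using zero_morphism_comp_right v by metis
  moreover have "\<exists>!h. h \<in> hom C X (Dom C k) \<and> k \<cdot> h = x"
    if x: "x \<in> hom C X A" and fx: "is_zero_morphism C (f \<cdot> x)" for X x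
  proof -
    have uniq: "\<exists>!u. u \<in> hom C X Z"
      using Z hom_objD(1)[OF x] by (simp add: is_zero_object_def)
    then obtain u where u: "u \<in> hom C X Z"
      by blast
    have "f \<cdot> x = v \<cdot> u"
      using zero_morphism_unique[OF fx zero_morphism_comp_right[OF v(2,1) u]]
        cmp_hom[OF x f] cmp_hom[OF u v(1)] by blast
    moreover have "x \<in> hom C X (Dom C f)" "u \<in> hom C X (Dom C v)"
      using x u f v by (simp_all add: hom_def)
    ultimately have "\<exists>!h. h \<in> hom C X (Dom C k) \<and> k \<cdot> h = x \<and> q \<cdot> h = u"
      using pb unfolding is_pullback_def by blast
    moreover have "q \<cdot> h = u" if "h \<in> hom C X (Dom C k)" for h
      using uniq u cmp_hom[OF that q] by blast
    ultimately show ?thesis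
      by blast
  qed
  ultimately have "is_kernel C f k"
    using f k by (simp_all add: is_kernel_def hom_def)
  then show thesis ..
qed

text \<open>A cokernel of \<open>f\<close> is a coequalizer of \<open>f\<close> and the parallel
  zero morphism \<open>z\<close>.\<close>

lemma normal_epi_regular_epi:
  assumes Z: "is_zero_object C Z" and "is_normal_epi C e"
  shows "is_regular_epi C e"
proof -
  obtain f where c: "is_cokernel C f e"
    using assms(2) by (auto simp: is_normal_epi_def)
  then have f: "f \<in> hom C (Dom C f) (Cod C f)" and e: "e \<in> hom C (Cod C f) (Cod C e)"
    and ef: "is_zero_morphism C (e \<cdot> f)"
    by (simp_all add: is_cokernel_def hom_def)
  obtain z where z: "z \<in> hom C (Dom C f) (Cod C f)" "is_zero_morphism C z"
    using ex_zero_morphism[OF Z hom_objD[OF f]] .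
  have "x \<cdot> f = x \<cdot> z \<longleftrightarrow> is_zero_morphism C (x \<cdot> f)" if x: "x \<in> hom C (Cod C f) X" for X x
    using zero_morphism_unique[OF _ zero_morphism_comp_left[OF z(2,1) x]]
      zero_morphism_comp_left[OF z(2,1) x] cmp_hom[OF f x] cmp_hom[OF z(1) x] by metis
  then have "is_coequalizer C f z e"
    using c f z e ef unfolding is_cokernel_def is_coequalizer_def by (simp add: hom_def)
  then show ?thesis
    by (auto simp: is_regular_epi_def)
qed

section \<open>Normality implies that zero kernel means monomorphism\<close>

lemma normal_zero_kernel_mono:
  assumes reg: "regular_category C" and normal: "\<And>e. is_regular_epi C e \<Longrightarrow> is_normal_epi C e"
    and f: "f \<in> Arr C" and ker: "has_zero_kernel C f"
  shows "is_mono C f"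
proof -
  have fh: "f \<in> hom C (Dom C f) (Cod C f)"
    using f by (simp add: hom_def)
  obtain p q where pb: "is_pullback C f f p q"
    using ex_pullback[OF regular_category_finitely_complete[OF reg] fh fh] .
  have pq: "p \<in> hom C (Dom C p) (Dom C f)" "q \<in> hom C (Dom C p) (Dom C f)" "f \<cdot> p = f \<cdot> q"
    using pb by (simp_all add: is_pullback_def hom_def)
  obtain e where coeq: "is_coequalizer C p q e"
    using reg pb unfolding regular_category_def is_kernel_pair_def by meson
  then have e: "e \<in> hom C (Dom C f) (Cod C e)" and epq: "e \<cdot> p = e \<cdot> q"
    using pq by (simp_all add: is_coequalizer_def hom_def)
  obtain m where m: "m \<in> hom C (Cod C e) (Cod C f)" "m \<cdot> e = f"
    using coequalizer_factorE[OF coeq] pq(3) fh hom_CodD[OF pq(1)] by metis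
  obtain g where cok: "is_cokernel C g e"
    using normal coeq by (auto simp: is_regular_epi_def is_normal_epi_def)
  have g: "g \<in> hom C (Dom C g) (Dom C f)" and eg: "is_zero_morphism C (e \<cdot> g)"
    using cok e by (simp_all add: is_cokernel_def hom_def)
  have "f \<cdot> g = m \<cdot> (e \<cdot> g)"
    using assoc[OF g e m(1)] m(2) by simp
  then have "is_zero_morphism C (f \<cdot> g)"
    using zero_morphism_comp_left[OF eg cmp_hom[OF g e] m(1)] by simp
  then have gz: "is_zero_morphism C g"
    using zero_kernelD[OF ker g] by blast
  have I: "Idt C (Dom C f) \<in> hom C (Dom C f) (Dom C f)"
    using idt_hom dom_obj f by blast
  \<comment> \<open>Since \<open>g\<close> is zero, even the identity kills it and so factors
    through the cokernel \<open>e\<close>; the factor \<open>s\<close> is a retraction of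
    \<open>e\<close>.\<close>
  obtain s where s: "s \<in> hom C (Cod C e) (Dom C f)" "s \<cdot> e = Idt C (Dom C f)"
    using cokernel_factorE[OF cok] I gz idt_left[OF g] hom_CodD[OF g] by metis
  have "p = q"
    using assoc[OF pq(1) e s(1)] assoc[OF pq(2) e s(1)] epq s(2) idt_left pq(1,2) by metis
  \<comment> \<open>The pair \<open>x\<close>, \<open>y\<close> factors through the kernel pair as
    \<open>p \<cdot> h\<close>, \<open>q \<cdot> h\<close>.\<close>
  then have "x = y"
    if "x \<in> hom C X (Dom C f)" "y \<in> hom C X (Dom C f)" "f \<cdot> x = f \<cdot> y" for X x y
    using pb that unfolding is_pullback_def by blast
  then show ?thesis
    using f by (auto simp: is_mono_def)
qed

section \<open>The converse: regular epimorphisms are cokernels of their kernels\<close>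

text \<open>An \<open>x\<close> killed by \<open>m\<close> need not lift along \<open>c\<close>, but
  it does so after precomposing with \<open>c'\<close>, a pullback of \<open>c\<close>. Regularity
  makes \<open>c'\<close> a regular epimorphism, so it can be cancelled once
  \<open>x \<cdot> c'\<close> is known to be zero.\<close>

lemma cokernel_kernel_comparison_zero_kernel:
  assumes Z: "is_zero_object C Z" and reg: "regular_category C"
    and k: "is_kernel C e k" and c: "is_cokernel C k c"
    and m: "m \<in> hom C (Cod C c) (Cod C e)" "m \<cdot> c = e"
  shows "has_zero_kernel C m"
proof (rule zero_kernelI[OF Z])
  show "m \<in> Arr C"
    using hom_ArrD[OF m(1)] .
  have kh: "k \<in> hom C (Dom C k) (Dom C e)" and ch: "c \<in> hom C (Dom C e) (Cod C c)"
    and ck: "is_zero_morphism C (c \<cdot> k)"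
    using k c by (simp_all add: is_kernel_def is_cokernel_def hom_def)
  fix X x
  assume "x \<in> hom C X (Dom C m)" and mx: "is_zero_morphism C (m \<cdot> x)"
  then have x: "x \<in> hom C X (Cod C c)"
    using hom_DomD[OF m(1)] by simp
  obtain y c' where pb: "is_pullback C c x y c'"
    using ex_pullback[OF regular_category_finitely_complete[OF reg] ch x] .
  then have y: "y \<in> hom C (Dom C y) (Dom C e)" and c': "c' \<in> hom C (Dom C y) X"
    and sq: "c \<cdot> y = x \<cdot> c'"
    using ch x by (simp_all add: is_pullback_def hom_def)
  have "is_regular_epi C c"
    using normal_epi_regular_epi[OF Z] c by (auto simp: is_normal_epi_def)
  then have "is_regular_epi C c'"
    using reg pb unfolding regular_category_def by blast
  then obtain s t where coeq: "is_coequalizer C s t c'"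
    by (auto simp: is_regular_epi_def)
  have "e \<cdot> y = (m \<cdot> x) \<cdot> c'"
    using assoc[OF y ch m(1)] assoc[OF c' x m(1)] sq m(2) by simp
  then have "is_zero_morphism C (e \<cdot> y)"
    using zero_morphism_comp_right[OF mx cmp_hom[OF x m(1)] c'] by simp
  then obtain h where h: "h \<in> hom C (Dom C y) (Dom C k)" "k \<cdot> h = y"
    using kernel_factorE[OF k y] by metis
  have "x \<cdot> c' = (c \<cdot> k) \<cdot> h"
    using assoc[OF h(1) kh ch] h(2) sq by simp
  then have xc': "is_zero_morphism C (x \<cdot> c')"
    using zero_morphism_comp_right[OF ck cmp_hom[OF kh ch] h(1)] by simp
  obtain z where z: "z \<in> hom C X (Cod C c)" "is_zero_morphism C z"
    using ex_zero_morphism[OF Z hom_objD[OF x]] .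
  have "x \<cdot> c' = z \<cdot> c'"
    using zero_morphism_unique[OF xc' zero_morphism_comp_right[OF z(2,1) c']]
      cmp_hom[OF c' x] cmp_hom[OF c' z(1)] by blast
  then have "x = z"
    using coequalizer_cancel[OF coeq, unfolded hom_CodD[OF c'], OF x z(1)] by simp
  then show "is_zero_morphism C x"
    using z by simp
qed

lemma regular_epi_normal_epi:
  assumes Z: "is_zero_object C Z" and reg: "regular_category C" and "has_cokernels C"
    and mono: "\<And>f. f \<in> Arr C \<Longrightarrow> has_zero_kernel C f \<Longrightarrow> is_mono C f"
    and "is_regular_epi C e"
  shows "is_normal_epi C e"
proof -
  obtain f g where coeq: "is_coequalizer C f g e"
    using assms(5) by (auto simp: is_regular_epi_def)
  then have eh: "e \<in> hom C (Dom C e) (Cod C e)" and fg: "f \<in> hom C (Dom C f) (Dom C e)"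
      "g \<in> hom C (Dom C f) (Dom C e)" and efg: "e \<cdot> f = e \<cdot> g"
    by (simp_all add: is_coequalizer_def hom_def)
  obtain k where k: "is_kernel C e k"
    using ex_kernel[OF Z regular_category_finitely_complete[OF reg] eh] .
  then have kh: "k \<in> hom C (Dom C k) (Dom C e)" and ek: "is_zero_morphism C (e \<cdot> k)"
    by (simp_all add: is_kernel_def hom_def)
  obtain c where c: "is_cokernel C k c"
    using assms(3) kh by (auto simp: has_cokernels_def hom_def)
  then have ch: "c \<in> hom C (Dom C e) (Cod C c)"
    using kh by (simp_all add: is_cokernel_def hom_def)
  obtain m where m: "m \<in> hom C (Cod C c) (Cod C e)" "m \<cdot> c = e"
    using cokernel_factorE[OF c] eh ek hom_CodD[OF kh] by metis
  have "is_mono C m"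
    using mono[OF hom_ArrD[OF m(1)] cokernel_kernel_comparison_zero_kernel[OF Z reg k c m]] .
  moreover have "m \<cdot> (c \<cdot> f) = m \<cdot> (c \<cdot> g)"
    using assoc[OF fg(1) ch m(1)] assoc[OF fg(2) ch m(1)] m(2) efg by simp
  \<comment> \<open>Cancelling the monomorphism \<open>m\<close> shows that \<open>c\<close>
    identifies the pair coequalized by \<open>e\<close>, so \<open>c\<close> factors back through
    \<open>e\<close>.\<close>
  ultimately have "c \<cdot> f = c \<cdot> g"
    using cmp_hom[OF fg(1) ch] cmp_hom[OF fg(2) ch] hom_DomD[OF m(1)]
    unfolding is_mono_def by metis
  then obtain n where n: "n \<in> hom C (Cod C e) (Cod C c)" "n \<cdot> e = c"
    using coequalizer_factorE[OF coeq] ch hom_CodD[OF fg(1)] by metis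
  have "\<exists>!h. h \<in> hom C (Cod C e) X \<and> h \<cdot> e = x"
    if x: "x \<in> hom C (Dom C e) X" and xk: "is_zero_morphism C (x \<cdot> k)" for X x
  proof -
    obtain h where h: "h \<in> hom C (Cod C c) X" "h \<cdot> c = x"
      using cokernel_factorE[OF c] x xk hom_CodD[OF kh] by metis
    \<comment> \<open>The factorization of \<open>x\<close> through \<open>c\<close> is carried to
      \<open>e\<close> along \<open>n\<close>; uniqueness holds because \<open>e\<close> is an
      epimorphism.\<close>
    have "(h \<cdot> n) \<cdot> e = x"
      using assoc[OF eh n(1) h(1)] n(2) h(2) by simp
    then show ?thesis
      using cmp_hom[OF n(1) h(1)] coequalizer_cancel[OF coeq] by metis
  qed
  then have "is_cokernel C k e"
    using kh eh ek by (simp add: is_cokernel_def hom_def)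
  then show ?thesis
    by (auto simp: is_normal_epi_def)
qed

end

theorem proposition3p6:
  fixes C :: "('o, 'a) cat"
  assumes "pointed_category C"
    and "regular_category C"
    and "has_cokernels C"
  shows "normal_category C \<longleftrightarrow> (\<forall>f\<in>Arr C. is_mono C f \<longleftrightarrow> has_zero_kernel C f)"
proof -
  interpret category C
    using assms(1) by (simp add: pointed_category_def)
  obtain Z where Z: "is_zero_object C Z"
    using assms(1) by (auto simp: pointed_category_def)
  show ?thesis
    \<comment> \<open>Monomorphisms always have zero kernel, so the condition amounts to its other
      implication, which the two main lemmas relate to normality.\<close>
    using mono_zero_kernel[OF Z] normal_zero_kernel_mono[OF assms(2)]
      regular_epi_normal_epi[OF Z assms(2,3)] assms(1,2)
    unfolding normal_category_def by blast
qed

end
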